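(* Let $F:\mathbb{R}^n\to\mathbb{R}$ be differentiable and $\mu_F$-strongly convex, let $G:\mathbb{R}^m\to\mathbb{R}$ be differentiable and $\mu_G$-strongly convex ($\mu_F,\mu_G>0$), with $\nabla F$ and $\nabla G$ locally Lipschitz continuous, and let $A\in\mathbb{R}^{m\times n}$. Let $\gamma=\max\{\frac{1}{\sqrt{\mu_F}},\frac{1}{\sqrt{\mu_G}}\}$, $t_0\ge 0$, and let $(x(t),y(t))$, $t\in[t_0,+\infty)$, be a global (twice continuously differentiable) solution of $$\begin{cases}\ddot x(t)+2\sqrt{\mu_F}\,\dot x(t)+\nabla F(x(t))+A^T(y(t)+\gamma\dot y(t))=0,\\ \ddot y(t)+2\sqrt{\mu_G}\,\dot y(t)+\nabla G(y(t))-A(x(t)+\gamma\dot x(t))=0,\end{cases}$$ with arbitrary initial data $(x(t_0),y(t_0),\dot x(t_0),\dot y(t_0))=(x_0,y_0,u_0,v_0)$. Let $(x^*,y^* )$ be the unique saddle point of $\mathcal{L}(x,y)=F(x)+\langle Ax,y\rangle-G(y)$. Then, as $t\to+\infty$: (i) $\mathcal{L}(x(t),y^* )-\mathcal{L}(x^*,y(t))\le\mathcal{O}\left(e^{-\min\{\sqrt{\mu_F},\sqrt{\mu_G}\}t}\right)$; (ii) $\|x(t)-x^*\|^2+\|y(t)-y^*\|^2\le\mathcal{O}\left(e^{-\min\{\sqrt{\mu_F},\sqrt{\mu_G}\}t}\right)$; (iii) $\|\dot x(t)\|^2+\|\dot y(t)\|^2\le\mathcal{O}\left(e^{-\min\{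\sqrt{\mu_F},\sqrt{\mu_G}\}t}\right)$.
   Context: $\langle\cdot,\cdot\rangle$ and $\|\cdot\|$ are the Euclidean inner product and norm. A differentiable function $F:\mathbb{R}^n\to\mathbb{R}$ is $\mu_F$-strongly convex if $F(y)-F(x)-\langle\nabla F(x),y-x\rangle\ge\frac{\mu_F}{2}\|y-x\|^2$ for all $x,y$; similarly for $G$. Since $F$ and $G$ are strongly convex, there is a unique $(x^*,y^* )\in\mathbb{R}^n\times\mathbb{R}^m$ with $\mathcal{L}(x^*,y)\le\mathcal{L}(x^*,y^* )\le\mathcal{L}(x,y^* )$ for all $(x,y)\in\mathbb{R}^n\times\mathbb{R}^m$. A bound $f(t)\le\mathcal{O}(g(t))$ means that there is a constant $C>0$, which may depend on the problem data, $t_0$ and the initial conditions but not on $t$, such that $f(t)\le C g(t)$ for all $t\ge t_0$. *)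

theory Defs
  imports "HOL-Analysis.Analysis"
begin

definition gradient :: "('a::real_inner \<Rightarrow> real) \<Rightarrow> 'a \<Rightarrow> 'a" where
  "gradient f x = (THE D. GDERIV f x :> D)"

lemma gradient_eqI:
  assumes "GDERIV f x :> D"
  shows "gradient f x = D"
  unfolding gradient_def
proof (rule the_equality)
  show "GDERIV f x :> D" by (fact assms)
next
  fix D' assume "GDERIV f x :> D'"
  then have "(\<lambda>h. inner h D') = (\<lambda>h. inner h D)"
    using assms unfolding gderiv_def by (rule has_derivative_unique)
  then show "D' = D"
    by (metis vector_eq_ldot inner_commute)
qed

lemma GDERIV_gradient:
  fixes f :: "'a::euclidean_space \<Rightarrow> real"
  assumes "f differentiable (at x)"
  shows "GDERIV f x :> gradient f x"
proof -
  obtain f' where f': "(f has_derivative f') (at x)"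
    using assms by (auto simp: differentiable_def)
  then have lin: "linear f'"
    by (rule has_derivative_linear)
  have "f' = (\<lambda>h. inner h (adjoint f' 1))"
    using adjoint_works[OF lin, of _ 1] by (auto simp: fun_eq_iff)
  with f' have "GDERIV f x :> adjoint f' 1"
    unfolding gderiv_def by simp
  then show ?thesis
    using gradient_eqI by metis
qed

text \<open>
  This is the inequality only: differentiability of \<open>f\<close> and positivity of \<open>\<mu>\<close> have to be
  assumed separately.
\<close>

definition strongly_convex :: "real \<Rightarrow> ('a::real_inner \<Rightarrow> real) \<Rightarrow> bool" where
  "strongly_convex \<mu> f \<longleftrightarrow>
     (\<forall>x y. f y - f x - inner (gradient f x) (y - x) \<ge> \<mu> / 2 * (norm (y - x))\<^sup>2)"

text \<open>The library notion \<^const>\<open>local_lipschitz\<close> carries a time parameter, which is irrelevant here.\<close>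

abbreviation locally_lipschitz :: "('a::metric_space \<Rightarrow> 'b::metric_space) \<Rightarrow> bool" where
  "locally_lipschitz f \<equiv> local_lipschitz (UNIV :: real set) UNIV (\<lambda>_. f)"

definition lagrangian ::
  "(real ^ 'n \<Rightarrow> real) \<Rightarrow> (real ^ 'm \<Rightarrow> real) \<Rightarrow> real ^ 'n ^ 'm \<Rightarrow> real ^ 'n \<Rightarrow> real ^ 'm \<Rightarrow> real"
  where "lagrangian F G A x y = F x + inner (A *v x) y - G y"

definition saddle_point :: "('a \<Rightarrow> 'b \<Rightarrow> real) \<Rightarrow> 'a \<Rightarrow> 'b \<Rightarrow> bool" where
  "saddle_point L xs ys \<longleftrightarrow> (\<forall>x y. L xs y \<le> L xs ys \<and> L xs ys \<le> L x ys)"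

text \<open>
  \<open>x'\<close> and \<open>x''\<close> are the first two derivatives of \<open>x\<close> on \<open>[t0, \<infinity>)\<close>, one-sided at \<open>t0\<close>.
\<close>

definition C2_on_with_derivs ::
  "real \<Rightarrow> (real \<Rightarrow> 'a::real_normed_vector) \<Rightarrow> (real \<Rightarrow> 'a) \<Rightarrow> (real \<Rightarrow> 'a) \<Rightarrow> bool" where
  "C2_on_with_derivs t0 x x' x'' \<longleftrightarrow>
     (\<forall>t\<ge>t0. (x has_vector_derivative x' t) (at t within {t0..})) \<and>
     (\<forall>t\<ge>t0. (x' has_vector_derivative x'' t) (at t within {t0..})) \<and>
     continuous_on {t0..} x''"

definition primal_dual_solution ::
  "(real ^ 'n \<Rightarrow> real) \<Rightarrow> (real ^ 'm \<Rightarrow> real) \<Rightarrow> real ^ 'n ^ 'm \<Rightarrow> real \<Rightarrow> real \<Rightarrow> real \<Rightarrow> real \<Rightarrow>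
   (real \<Rightarrow> real ^ 'n) \<Rightarrow> (real \<Rightarrow> real ^ 'm) \<Rightarrow> (real \<Rightarrow> real ^ 'n) \<Rightarrow> (real \<Rightarrow> real ^ 'm) \<Rightarrow> bool" where
  "primal_dual_solution F G A \<mu>F \<mu>G \<gamma> t0 x y x' y' \<longleftrightarrow>
     (\<exists>x'' y''. C2_on_with_derivs t0 x x' x'' \<and> C2_on_with_derivs t0 y y' y'' \<and>
        (\<forall>t\<ge>t0.
           x'' t + (2 * sqrt \<mu>F) *\<^sub>R x' t + gradient F (x t)
             + transpose A *v (y t + \<gamma> *\<^sub>R y' t) = 0 \<and>
           y'' t + (2 * sqrt \<mu>G) *\<^sub>R y' t + gradient G (y t)
             - A *v (x t + \<gamma> *\<^sub>R x' t) = 0))"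

end

theory Submission
  imports Defs
begin

text \<open>
  Let \<open>\<theta> = min (sqrt \<mu>F) (sqrt \<mu>G) = 1 / \<gamma>\<close>. Testing the two equations with \<open>\<theta> (x - xs) + x'\<close> and
  \<open>\<theta> (y - ys) + y'\<close> makes the coupling terms cancel, and each component then has the energy
  \<open>D(x, xs) + |\<theta> (x - xs) + x'|\<^sup>2 / 2 + \<theta> (a - \<theta>) |x - xs|\<^sup>2\<close>, where \<open>D\<close> is the Bregman distance of the
  objective and \<open>2 a\<close> the damping coefficient. The weight \<open>\<theta> (a - \<theta>)\<close> is the one for which the
  products \<open>\<langle>x - xs, x'\<rangle>\<close> disappear from the estimate \<open>E' + \<theta> E \<le> 0\<close>. The Bregman distances
  sum up to the primal-dual gap, and the energy controls all three quantities.
\<close>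

section \<open>Bregman distances of strongly convex functions\<close>

definition bregman :: "('a::real_inner \<Rightarrow> real) \<Rightarrow> 'a \<Rightarrow> 'a \<Rightarrow> real" where
  "bregman f x z = f x - f z - inner (gradient f z) (x - z)"

lemma strongly_convex_bregman:
  "strongly_convex \<mu> f \<Longrightarrow> \<mu> / 2 * (norm (x - z))\<^sup>2 \<le> bregman f x z"
  by (simp add: strongly_convex_def bregman_def)

text \<open>The Bregman distances from \<open>x\<close> to \<open>z\<close> and from
  \<open>z\<close> to \<open>x\<close> add up to the right-hand side. Only the second is estimated
  by strong convexity; the first is kept because it cancels against the energy.\<close>

lemma bregman_le_inner_gradient_diff:
  assumes "strongly_convex \<mu> f"
  shows "bregman f x z + \<mu> / 2 * (norm (x - z))\<^sup>2 \<le> inner (gradient f x - gradient f z) (x - z)"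
proof -
  have "bregman f x z + bregman f z x = inner (gradient f x - gradient f z) (x - z)"
    by (simp add: bregman_def algebra_simps inner_diff_left inner_diff_right)
  with strongly_convex_bregman[OF assms, of z x] show ?thesis
    by (simp add: norm_minus_commute)
qed

section \<open>Energy of one damped component\<close>

definition inertial_energy ::
  "('a::real_inner \<Rightarrow> real) \<Rightarrow> real \<Rightarrow> real \<Rightarrow> 'a \<Rightarrow> 'a \<Rightarrow> 'a \<Rightarrow> real" where
  "inertial_energy f a \<theta> z x v =
     bregman f x z + (norm (\<theta> *\<^sub>R (x - z) + v))\<^sup>2 / 2 + \<theta> * (a - \<theta>) * (norm (x - z))\<^sup>2"

text \<open>The forcing \<open>w\<close> stands for the coupling term relative to equilibrium. The
  modulus is tied to the damping \<open>2 * a\<close> by \<mu> = \<open>a\<^sup>2\<close>.\<close>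

lemma inertial_energy_decay:
  fixes f :: "'a::euclidean_space \<Rightarrow> real"
  assumes diff: "\<And>x. f differentiable (at x)" and conv: "strongly_convex (a\<^sup>2) f"
    and \<theta>: "0 < \<theta>" "\<theta> \<le> a"
    and x: "(x has_vector_derivative x' t) (at t within S)"
    and x': "(x' has_vector_derivative x'') (at t within S)"
    and ode: "x'' + (2 * a) *\<^sub>R x' t + gradient f (x t) - gradient f z + w = 0"
  obtains D where
    "((\<lambda>t. inertial_energy f a \<theta> z (x t) (x' t)) has_real_derivative D) (at t within S)"
    "D + \<theta> * inertial_energy f a \<theta> z (x t) (x' t) \<le> - inner (\<theta> *\<^sub>R (x t - z) + x' t) w"
proof -
  define \<xi> where "\<xi> = x t - z"
  define v where "v = x' t"
  define g where "g = gradient f (x t) - gradient f z"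
  define D where "D = inner v g + inner (\<theta> *\<^sub>R \<xi> + v) (\<theta> *\<^sub>R v + x'')
    + 2 * \<theta> * (a - \<theta>) * inner \<xi> v"
  have fx: "((\<lambda>t. f (x t)) has_real_derivative inner v (gradient f (x t))) (at t within S)"
  proof -
    have "(f has_derivative (\<lambda>h. inner h (gradient f (x t)))) (at (x t))"
      using GDERIV_gradient[OF diff] by (simp add: gderiv_def)
    from has_derivative_compose[OF x[unfolded has_vector_derivative_def] this]
    show ?thesis
      by (rule has_derivative_imp_has_field_derivative) (simp add: v_def)
  qed
  have "((\<lambda>t. inertial_energy f a \<theta> z (x t) (x' t)) has_real_derivative D) (at t within S)"
    unfolding inertial_energy_def bregman_def power2_norm_eq_inner
    unfolding has_real_derivative_iff_has_vector_derivative D_def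
    by (rule derivative_eq_intros fx[unfolded has_real_derivative_iff_has_vector_derivative] x x' refl
      bounded_bilinear.has_vector_derivative[OF bounded_bilinear_inner])+
      (simp add: \<xi>_def v_def g_def inner_diff_right inner_add_right inner_add_left
        inner_diff_left inner_commute field_simps)
  moreover have "D + \<theta> * inertial_energy f a \<theta> z (x t) (x' t) \<le> - inner (\<theta> *\<^sub>R \<xi> + v) w"
  proof -
    have x''_eq: "x'' = - ((2 * a) *\<^sub>R v) - g - w"
      using ode by (simp add: v_def g_def algebra_simps add_eq_0_iff)
    have "\<theta> * (bregman f (x t) z + a\<^sup>2 / 2 * (norm \<xi>)\<^sup>2) \<le> \<theta> * inner g \<xi>"
      using \<theta> bregman_le_inner_gradient_diff[OF conv, of "x t" z]
      by (simp add: \<xi>_def g_def)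
    \<comment> \<open>The chain-rule term \<open>inner v g\<close> cancels against the equation
      tested with \<open>v\<close>. The coefficient of \<open>inner \<xi> v\<close> is
      \<theta>(\<theta> - 2a) + 2\<theta>(a - \<theta>) + \<theta>^2 = 0, and that of |\<xi>|^2 is
      \<theta>^3/2 + \<theta>^2(a - \<theta>) = \<theta>a^2/2 - \<theta>(a - \<theta>)^2/2.\<close>
    moreover have "D + \<theta> * inertial_energy f a \<theta> z (x t) (x' t) =
        \<theta> * (bregman f (x t) z + a\<^sup>2 / 2 * (norm \<xi>)\<^sup>2) - \<theta> * inner g \<xi>
        - inner (\<theta> *\<^sub>R \<xi> + v) w - \<theta> / 2 * (a - \<theta>)\<^sup>2 * (norm \<xi>)\<^sup>2
        - (2 * a - 3 / 2 * \<theta>) * (norm v)\<^sup>2"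
      unfolding D_def inertial_energy_def x''_eq power2_norm_eq_inner \<xi>_def[symmetric] v_def[symmetric]
      by (simp add: inner_add_left inner_add_right inner_diff_left inner_diff_right
          inner_commute power2_eq_square field_simps)
    moreover have "0 \<le> \<theta> / 2 * (a - \<theta>)\<^sup>2 * (norm \<xi>)\<^sup>2" "0 \<le> (2 * a - 3 / 2 * \<theta>) * (norm v)\<^sup>2"
      using \<theta> by auto
    ultimately show ?thesis by linarith
  qed
  ultimately show ?thesis
    using that by (simp add: \<xi>_def v_def)
qed

text \<open>Gronwall's argument: the integrating factor \<open>exp (c * t)\<close> makes the product
  nonincreasing.\<close>

lemma exp_decay_of_differential_inequality:
  fixes E :: "real \<Rightarrow> real"
  assumes "\<And>t. t0 \<le> t \<Longrightarrow> \<exists>D. (E has_real_derivative D) (at t within {t0..}) \<and> D + c * E t \<le> 0"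
    and "t0 \<le> t"
  shows "E t \<le> E t0 * exp (c * t0) * exp (- (c * t))"
proof -
  let ?h = "\<lambda>s. E s * exp (c * s)"
  have h: "\<exists>D. (?h has_real_derivative D) (at s within {t0..}) \<and> D \<le> 0" if s: "t0 \<le> s" for s
  proof -
    obtain D where D: "(E has_real_derivative D) (at s within {t0..})" "D + c * E s \<le> 0"
      using assms(1)[OF s] by blast
    have "(?h has_real_derivative (D + c * E s) * exp (c * s)) (at s within {t0..})"
      by (rule derivative_eq_intros D refl)+ (simp add: algebra_simps)
    with D(2) show ?thesis by (meson exp_ge_zero mult_nonpos_nonneg)
  qed
  have "?h t \<le> ?h t0"
  \<comment> \<open>The derivative at \<open>t0\<close> is only one-sided, so two-sided derivatives
    are used on the open interval and continuity covers the endpoint.\<close>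
  proof (rule DERIV_nonpos_imp_decreasing_open[OF \<open>t0 \<le> t\<close>])
    fix s assume "t0 < s"
    moreover from this have "at s within {t0..} = at s"
      by (intro at_within_interior) simp
    ultimately show "\<exists>D. (?h has_real_derivative D) (at s) \<and> D \<le> 0"
      using h[of s] by simp
  next
    have "continuous_on {t0..} ?h"
      unfolding continuous_on_eq_continuous_within
      using h by (meson DERIV_continuous atLeast_iff)
    then show "continuous_on {t0..t} ?h"
      by (rule continuous_on_subset) auto
  qed
  then show ?thesis
    by (simp add: exp_minus field_simps)
qed

text \<open>As \<theta> \<le> a, all three summands of the energy are nonnegative, so each is
  bounded by the whole. Strong convexity and \<theta>^2 \<le> a^2 turn the first into a distance
  bound.\<close>

lemma inertial_energy_bounds:
  assumes conv: "strongly_convex (a\<^sup>2) f" and \<theta>: "0 < \<theta>" "\<theta> \<le> a"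
  shows "bregman f x z \<le> inertial_energy f a \<theta> z x v"
    and "(norm (x - z))\<^sup>2 \<le> 2 / \<theta>\<^sup>2 * inertial_energy f a \<theta> z x v"
    and "(norm v)\<^sup>2 \<le> 8 * inertial_energy f a \<theta> z x v"
proof -
  let ?E = "inertial_energy f a \<theta> z x v"
  have quad: "\<theta>\<^sup>2 / 2 * (norm (x - z))\<^sup>2 \<le> bregman f x z"
    using strongly_convex_bregman[OF conv, of x z] power_mono[OF \<theta>(2), of 2] \<theta>
      mult_right_mono[of "\<theta>\<^sup>2 / 2" "a\<^sup>2 / 2" "(norm (x - z))\<^sup>2"] by simp
  have rest: "0 \<le> \<theta> * (a - \<theta>) * (norm (x - z))\<^sup>2"
    using \<theta> by simp
  show breg: "bregman f x z \<le> ?E"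
    using rest by (simp add: inertial_energy_def)
  with quad have "\<theta>\<^sup>2 * (norm (x - z))\<^sup>2 \<le> 2 * ?E" by simp
  with \<theta> show "(norm (x - z))\<^sup>2 \<le> 2 / \<theta>\<^sup>2 * ?E"
    by (simp add: field_simps)
  have "0 \<le> bregman f x z"
    by (rule order_trans[OF _ quad]) simp
  with rest have 1: "(norm (\<theta> *\<^sub>R (x - z) + v))\<^sup>2 \<le> 2 * ?E"
    by (simp add: inertial_energy_def)
  \<comment> \<open>Parallelogram law for \<theta>(x - z) + v and \<theta>(x - z), whose difference
    is \<open>v\<close>. Both have squared norm at most \<open>2 * ?E\<close>, whence the factor
    8.\<close>
  have "(norm v)\<^sup>2 + (norm (\<theta> *\<^sub>R (x - z) + (\<theta> *\<^sub>R (x - z) + v)))\<^sup>2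
      = 2 * (norm (\<theta> *\<^sub>R (x - z) + v))\<^sup>2 + 2 * (norm (\<theta> *\<^sub>R (x - z)))\<^sup>2"
    unfolding power2_norm_eq_inner
    by (simp add: inner_add_left inner_add_right inner_commute algebra_simps)
  moreover have "(norm (\<theta> *\<^sub>R (x - z)))\<^sup>2 = \<theta>\<^sup>2 * (norm (x - z))\<^sup>2"
    by (simp add: power_mult_distrib)
  ultimately show "(norm v)\<^sup>2 \<le> 8 * ?E"
    using 1 quad breg zero_le_power2[of "norm (\<theta> *\<^sub>R (x - z) + (\<theta> *\<^sub>R (x - z) + v))"] by linarith
qed

section \<open>First-order conditions at the saddle point\<close>

lemma inner_transpose_matrix_vector:
  fixes A :: "real ^ 'n ^ 'm"
  shows "inner u (transpose A *v v) = inner (A *v u) v"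
  by (metis dot_lmul_matrix inner_commute vector_transpose_matrix transpose_transpose)

lemma gradient_eq_of_affine_minimum:
  fixes f :: "'a::euclidean_space \<Rightarrow> real"
  assumes "f differentiable (at z)" and "\<And>x. f z + inner z c \<le> f x + inner x c"
  shows "gradient f z = - c"
proof -
  have "((\<lambda>x. f x + inner x c) has_derivative (\<lambda>h. inner h (gradient f z) + inner h c)) (at z)"
    using GDERIV_gradient[OF assms(1)] unfolding gderiv_def
    by (intro derivative_intros) auto
  then have "(\<lambda>h. inner h (gradient f z) + inner h c) = (\<lambda>h. 0)"
    by (rule has_derivative_local_min) (simp add: assms(2))
  \<comment> \<open>The vanishing derivative is evaluated in the direction
    \<open>gradient f z + c\<close> itself.\<close>
  then have "inner (gradient f z + c) (gradient f z + c) = 0"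
    by (metis inner_add_right)
  then show ?thesis
    by (simp add: eq_neg_iff_add_eq_0)
qed

text \<open>With one argument frozen at the saddle point, the Lagrangian is, up to a constant,
  \<open>F\<close> plus a linear term, or the negative of \<open>G\<close> plus a linear
  term.\<close>

lemma saddle_point_lagrangian_gradients:
  assumes saddle: "saddle_point (lagrangian F G A) xs ys"
    and F: "F differentiable (at xs)" and G: "G differentiable (at ys)"
  shows "gradient F xs = - (transpose A *v ys)" and "gradient G ys = A *v xs"
proof -
  show "gradient F xs = - (transpose A *v ys)"
    using saddle unfolding saddle_point_def lagrangian_def
    by (intro gradient_eq_of_affine_minimum F) (simp add: inner_transpose_matrix_vector del: transpose_matrix_vector)
  have "gradient G ys = - (- (A *v xs))"
  proof (intro gradient_eq_of_affine_minimum G)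
    fix y
    have "lagrangian F G A xs y \<le> lagrangian F G A xs ys"
      using saddle by (simp add: saddle_point_def)
    then show "G ys + inner ys (- (A *v xs)) \<le> G y + inner y (- (A *v xs))"
      by (simp add: lagrangian_def inner_commute)
  qed
  then show "gradient G ys = A *v xs" by simp
qed

section \<open>The coupled system and its decay rates\<close>

theorem theorem2:
  fixes F :: "real ^ 'n \<Rightarrow> real" and G :: "real ^ 'm \<Rightarrow> real" and A :: "real ^ 'n ^ 'm"
    and \<mu>F \<mu>G \<gamma> t0 :: real
    and x0 u0 xs :: "real ^ 'n" and y0 v0 ys :: "real ^ 'm"
  assumes "\<mu>F > 0" and "\<mu>G > 0"
    and "\<And>x. F differentiable (at x)" and "\<And>y. G differentiable (at y)"
    and "strongly_convex \<mu>F F" and "strongly_convex \<mu>G G"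
    and "locally_lipschitz (gradient F)" and "locally_lipschitz (gradient G)"
    and "\<gamma> = max (1 / sqrt \<mu>F) (1 / sqrt \<mu>G)"
    and "t0 \<ge> 0"
    and "saddle_point (lagrangian F G A) xs ys"
  shows "\<exists>C1>0. \<exists>C2>0. \<exists>C3>0. \<forall>x y x' y'.
    primal_dual_solution F G A \<mu>F \<mu>G \<gamma> t0 x y x' y' \<longrightarrow>
    x t0 = x0 \<longrightarrow> y t0 = y0 \<longrightarrow> x' t0 = u0 \<longrightarrow> y' t0 = v0 \<longrightarrow>
    (\<forall>t\<ge>t0. lagrangian F G A (x t) ys - lagrangian F G A xs (y t)
               \<le> C1 * exp (- (min (sqrt \<mu>F) (sqrt \<mu>G) * t))) \<and>
    (\<forall>t\<ge>t0. (norm (x t - xs))\<^sup>2 + (norm (y t - ys))\<^sup>2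
               \<le> C2 * exp (- (min (sqrt \<mu>F) (sqrt \<mu>G) * t))) \<and>
    (\<forall>t\<ge>t0. (norm (x' t))\<^sup>2 + (norm (y' t))\<^sup>2
               \<le> C3 * exp (- (min (sqrt \<mu>F) (sqrt \<mu>G) * t)))"
proof -
  let ?a = "sqrt \<mu>F" and ?b = "sqrt \<mu>G"
  define \<theta> where "\<theta> = min ?a ?b"
  have \<theta>: "0 < \<theta>" "\<theta> \<le> ?a" "\<theta> \<le> ?b"
    using assms(1,2) by (auto simp: \<theta>_def)
  have \<gamma>: "\<theta> * \<gamma> = 1"
    using assms(1,2) unfolding \<open>\<gamma> = _\<close> \<theta>_def
    by (auto simp: min_def max_def field_simps)
  have conv: "strongly_convex (?a\<^sup>2) F" "strongly_convex (?b\<^sup>2) G"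
    using assms by simp_all
  note opt = saddle_point_lagrangian_gradients[OF assms(11) assms(3) assms(4)]
  define E where "E x y x' y' = inertial_energy F ?a \<theta> xs x x' + inertial_energy G ?b \<theta> ys y y'"
    for x y x' y'
  have gap: "lagrangian F G A x ys - lagrangian F G A xs y \<le> E x y x' y'"
    and pos: "(norm (x - xs))\<^sup>2 + (norm (y - ys))\<^sup>2 \<le> 2 / \<theta>\<^sup>2 * E x y x' y'"
    and vel: "(norm x')\<^sup>2 + (norm y')\<^sup>2 \<le> 8 * E x y x' y'" for x y x' y'
  proof -
    note xb = inertial_energy_bounds[OF conv(1) \<theta>(1,2), where x = x and z = xs and v = x']
    note yb = inertial_energy_bounds[OF conv(2) \<theta>(1,3), where x = y and z = ys and v = y']
    \<comment> \<open>The optimality conditions turn the linear parts of the Bregman distances into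
      coupling terms; the two copies of \<open>inner (A *v xs) ys\<close> cancel.\<close>
    have "lagrangian F G A x ys - lagrangian F G A xs y = bregman F x xs + bregman G y ys"
      using inner_transpose_matrix_vector[of x A ys] inner_transpose_matrix_vector[of xs A ys]
      by (simp add: lagrangian_def bregman_def opt inner_diff_right inner_commute)
    with xb(1) yb(1) show "lagrangian F G A x ys - lagrangian F G A xs y \<le> E x y x' y'"
      by (simp add: E_def)
    show "(norm (x - xs))\<^sup>2 + (norm (y - ys))\<^sup>2 \<le> 2 / \<theta>\<^sup>2 * E x y x' y'"
      using add_mono[OF xb(2) yb(2)] by (simp add: E_def distrib_left)
    show "(norm x')\<^sup>2 + (norm y')\<^sup>2 \<le> 8 * E x y x' y'"
      using add_mono[OF xb(3) yb(3)] by (simp add: E_def distrib_left)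
  qed
  \<comment> \<open>\<open>K\<close> depends on the initial data but not on the trajectory. The
    summand 1 keeps it positive when the motion starts at rest in the saddle point.\<close>
  define K where "K = E x0 y0 u0 v0 * exp (\<theta> * t0) + 1"
  have "0 \<le> 8 * E x0 y0 u0 v0"
    by (rule order_trans[OF _ vel]) simp
  then have "K > 0"
    by (simp add: K_def add_nonneg_pos)
  have decay: "E (x t) (y t) (x' t) (y' t) \<le> K * exp (- (\<theta> * t))"
    if sol: "primal_dual_solution F G A \<mu>F \<mu>G \<gamma> t0 x y x' y'"
      and init: "x t0 = x0" "y t0 = y0" "x' t0 = u0" "y' t0 = v0" and "t0 \<le> t" for x y x' y' t
  proof -
    obtain x'' y'' where d: "C2_on_with_derivs t0 x x' x''" "C2_on_with_derivs t0 y y' y''"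
      and ode: "\<And>t. t0 \<le> t \<Longrightarrow> x'' t + (2 * ?a) *\<^sub>R x' t + gradient F (x t)
             + transpose A *v (y t + \<gamma> *\<^sub>R y' t) = 0"
        "\<And>t. t0 \<le> t \<Longrightarrow> y'' t + (2 * ?b) *\<^sub>R y' t + gradient G (y t)
             - A *v (x t + \<gamma> *\<^sub>R x' t) = 0"
      using sol unfolding primal_dual_solution_def by blast
    have dx: "(x has_vector_derivative x' s) (at s within {t0..})"
        "(x' has_vector_derivative x'' s) (at s within {t0..})"
      and dy: "(y has_vector_derivative y' s) (at s within {t0..})"
        "(y' has_vector_derivative y'' s) (at s within {t0..})" if "t0 \<le> s" for s
      using d that by (simp_all add: C2_on_with_derivs_def)
    have "\<exists>D. ((\<lambda>s. E (x s) (y s) (x' s) (y' s)) has_real_derivative D) (at s within {t0..})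
        \<and> D + \<theta> * E (x s) (y s) (x' s) (y' s) \<le> 0" if s: "t0 \<le> s" for s
    proof -
      define p where "p = \<theta> *\<^sub>R (x s - xs) + x' s"
      define q where "q = \<theta> *\<^sub>R (y s - ys) + y' s"
      \<comment> \<open>By \<theta>\<gamma> = 1, the rescaled test vectors are the extrapolated
        displacements in the coupling.\<close>
      have scale: "\<gamma> *\<^sub>R p = (x s - xs) + \<gamma> *\<^sub>R x' s" "\<gamma> *\<^sub>R q = (y s - ys) + \<gamma> *\<^sub>R y' s"
        using \<gamma> by (simp_all add: p_def q_def scaleR_add_right mult.commute)
      \<comment> \<open>Subtracting the equilibrium condition
        \<open>gradient F xs + transpose A *v ys = 0\<close> leaves a coupling in \<open>q\<close>
        alone; the equation for \<open>y\<close> is treated likewise with \<open>p\<close>.\<close>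
      have ode_x: "x'' s + (2 * ?a) *\<^sub>R x' s + gradient F (x s) - gradient F xs
          + transpose A *v (\<gamma> *\<^sub>R q) = 0"
        using ode(1)[OF s] unfolding scale opt
        by (simp add: algebra_simps)
      obtain D1 where D1:
        "((\<lambda>s. inertial_energy F ?a \<theta> xs (x s) (x' s)) has_real_derivative D1) (at s within {t0..})"
        "D1 + \<theta> * inertial_energy F ?a \<theta> xs (x s) (x' s) \<le> - inner p (transpose A *v (\<gamma> *\<^sub>R q))"
        by (rule inertial_energy_decay[OF assms(3) conv(1) \<theta>(1,2) dx[OF s] ode_x,
              folded p_def])
      have ode_y: "y'' s + (2 * ?b) *\<^sub>R y' s + gradient G (y s) - gradient G ys
          + - (A *v (\<gamma> *\<^sub>R p)) = 0"
        using ode(2)[OF s] unfolding scale opt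
        by (simp add: algebra_simps)
      obtain D2 where D2:
        "((\<lambda>s. inertial_energy G ?b \<theta> ys (y s) (y' s)) has_real_derivative D2) (at s within {t0..})"
        "D2 + \<theta> * inertial_energy G ?b \<theta> ys (y s) (y' s) \<le> - inner q (- (A *v (\<gamma> *\<^sub>R p)))"
        by (rule inertial_energy_decay[OF assms(4) conv(2) \<theta>(1,3) dy[OF s] ode_y,
              folded q_def])
      \<comment> \<open>By adjointness the coupling contributions of the two components are
        opposite, so they drop out of the sum.\<close>
      have "inner p (transpose A *v (\<gamma> *\<^sub>R q)) = inner q (A *v (\<gamma> *\<^sub>R p))"
        by (simp add: inner_transpose_matrix_vector matrix_vector_mult_scaleR inner_commute
            del: transpose_matrix_vector)
      with D1 D2 show ?thesis
        unfolding E_def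
        by (intro exI[of _ "D1 + D2"] conjI derivative_intros) (auto simp: distrib_left)
    qed
    from exp_decay_of_differential_inequality[OF this \<open>t0 \<le> t\<close>]
    have "E (x t) (y t) (x' t) (y' t) \<le> (K - 1) * exp (- (\<theta> * t))"
      by (simp add: K_def init)
    also have "\<dots> \<le> K * exp (- (\<theta> * t))"
      by (intro mult_right_mono) simp_all
    finally show ?thesis .
  qed
  have scaled: "u \<le> c * K * exp (- (\<theta> * t))"
    if "u \<le> c * e" "e \<le> K * exp (- (\<theta> * t))" "0 < c" for u c e t
    unfolding mult.assoc using that by (meson less_imp_le mult_left_mono order_trans)
  show ?thesis
    unfolding \<theta>_def[symmetric]
  \<comment> \<open>The factors 1, \<open>2 / \<theta>\<^sup>2\<close> and 8 come from
    \<open>gap\<close>, \<open>pos\<close> and \<open>vel\<close>.\<close>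
  proof (rule exI[of _ K], rule conjI[OF \<open>K > 0\<close>], rule exI[of _ "2 / \<theta>\<^sup>2 * K"], rule conjI,
      goal_cases)
    case 2
    show ?case
    proof (rule exI[of _ "8 * K"], intro conjI allI impI)
      fix x y x' y' t
      assume "primal_dual_solution F G A \<mu>F \<mu>G \<gamma> t0 x y x' y'"
        "x t0 = x0" "y t0 = y0" "x' t0 = u0" "y' t0 = v0" "t0 \<le> t"
      note decay = decay[OF this]
      show "lagrangian F G A (x t) ys - lagrangian F G A xs (y t) \<le> K * exp (- (\<theta> * t))"
        using gap decay by (rule order_trans)
      show "(norm (x t - xs))\<^sup>2 + (norm (y t - ys))\<^sup>2 \<le> 2 / \<theta>\<^sup>2 * K * exp (- (\<theta> * t))"
        using pos decay by (rule scaled) (use \<theta>(1) in simp)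
      show "(norm (x' t))\<^sup>2 + (norm (y' t))\<^sup>2 \<le> 8 * K * exp (- (\<theta> * t))"
        using vel decay by (rule scaled) simp
    qed (simp add: \<open>K > 0\<close>)
  qed (use \<theta>(1) \<open>K > 0\<close> in simp)
qed

end
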